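(* There exists a visibly pushdown language $L$ (in particular a deterministic context-free language) such that, for every $p$, any randomized $p$-pass streaming algorithm that tests membership in $L$ with probability of error at most a constant $\epsilon < \frac{1}{2}$ requires $\Omega(n/p)$ space on inputs of length $n$.
   Context: A visibly pushdown language is a language over an alphabet partitioned into call, return and internal symbols that is accepted by a pushdown automaton which pushes a symbol exactly when reading a call symbol, pops exactly when reading a return symbol, and does not change the stack on internal symbols; every such language is a deterministic context-free language. A $p$-pass streaming algorithm reads its input sequentially from left to right $p$ times; its space is the number of bits of working memory used. *)

theory Defs
  imports "HOL-Probability.Probability_Mass_Function"
begin

text \<open>
  Nondeterministic visibly pushdown automata in the sense of Alur and Madhusudan, over an
  alphabet split into calls, returns and internal symbols. The bottom-of-stack marker is left
  implicit: a configuration is a state together with the list of stack symbols above the marker.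
  In \<open>vpa_return\<close> the third component is \<open>Some g\<close> if the symbol \<open>g\<close> is popped, and \<open>None\<close> if the
  return is read on the bottom marker, which is then left in place.
\<close>

record 'a vpa =
  vpa_states :: "nat set"
  vpa_initial :: "nat set"
  vpa_final :: "nat set"
  vpa_stack :: "nat set"
  vpa_call :: "(nat \<times> 'a \<times> nat \<times> nat) set"
  vpa_return :: "(nat \<times> 'a \<times> nat option \<times> nat) set"
  vpa_internal :: "(nat \<times> 'a \<times> nat) set"

definition wf_vpa :: "'a set \<Rightarrow> 'a set \<Rightarrow> 'a set \<Rightarrow> 'a vpa \<Rightarrow> bool" where
  "wf_vpa calls returns internals M \<longleftrightarrow>
     finite (vpa_states M) \<and> finite (vpa_stack M) \<and>
     vpa_initial M \<subseteq> vpa_states M \<and> vpa_final M \<subseteq> vpa_states M \<and>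
     vpa_call M \<subseteq> vpa_states M \<times> calls \<times> vpa_states M \<times> vpa_stack M \<and>
     vpa_return M \<subseteq>
       vpa_states M \<times> returns \<times> insert None (Some ` vpa_stack M) \<times> vpa_states M \<and>
     vpa_internal M \<subseteq> vpa_states M \<times> internals \<times> vpa_states M"

inductive vpa_run :: "'a vpa \<Rightarrow> nat \<times> nat list \<Rightarrow> 'a list \<Rightarrow> nat \<times> nat list \<Rightarrow> bool"
  for M :: "'a vpa" where
  empty: "vpa_run M cf [] cf"
| call: "(q, a, q', g) \<in> vpa_call M \<Longrightarrow> vpa_run M (q', g # st) w cf
    \<Longrightarrow> vpa_run M (q, st) (a # w) cf"
| return_pop: "(q, a, Some g, q') \<in> vpa_return M \<Longrightarrow> vpa_run M (q', st) w cf
    \<Longrightarrow> vpa_run M (q, g # st) (a # w) cf"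
| return_bottom: "(q, a, None, q') \<in> vpa_return M \<Longrightarrow> vpa_run M (q', []) w cf
    \<Longrightarrow> vpa_run M (q, []) (a # w) cf"
| internal: "(q, a, q') \<in> vpa_internal M \<Longrightarrow> vpa_run M (q', st) w cf
    \<Longrightarrow> vpa_run M (q, st) (a # w) cf"

definition vpa_language :: "'a vpa \<Rightarrow> 'a list set" where
  "vpa_language M =
     {w. \<exists>q\<in>vpa_initial M. \<exists>f\<in>vpa_final M. \<exists>st. vpa_run M (q, []) w (f, st)}"

definition visibly_pushdown_language ::
    "'a set \<Rightarrow> 'a set \<Rightarrow> 'a set \<Rightarrow> 'a list set \<Rightarrow> bool" where
  "visibly_pushdown_language calls returns internals L \<longleftrightarrow>
     finite calls \<and> finite returns \<and> finite internals \<and>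
     calls \<inter> returns = {} \<and> calls \<inter> internals = {} \<and> returns \<inter> internals = {} \<and>
     (\<exists>M. wf_vpa calls returns internals M \<and> L = vpa_language M)"

text \<open>
  Deterministic pushdown automata with acceptance by final state. In \<open>dpda_trans M q x X\<close> the
  argument \<open>x\<close> is \<open>None\<close> for a move that reads no input, and \<open>X\<close> is the topmost stack symbol,
  which is replaced by the returned word (topmost symbol first).
\<close>

record 'a dpda =
  dpda_states :: "nat set"
  dpda_stack :: "nat set"
  dpda_start :: nat
  dpda_bottom :: nat
  dpda_final :: "nat set"
  dpda_trans :: "nat \<Rightarrow> 'a option \<Rightarrow> nat \<Rightarrow> (nat \<times> nat list) option"

definition wf_dpda :: "'a set \<Rightarrow> 'a dpda \<Rightarrow> bool" where
  "wf_dpda A M \<longleftrightarrow>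
     finite (dpda_states M) \<and> finite (dpda_stack M) \<and>
     dpda_start M \<in> dpda_states M \<and> dpda_bottom M \<in> dpda_stack M \<and>
     dpda_final M \<subseteq> dpda_states M \<and>
     (\<forall>q x X q' g. dpda_trans M q x X = Some (q', g) \<longrightarrow>
        q \<in> dpda_states M \<and> x \<in> insert None (Some ` A) \<and> X \<in> dpda_stack M \<and>
        q' \<in> dpda_states M \<and> g \<in> lists (dpda_stack M)) \<and>
     (\<forall>q X. dpda_trans M q None X \<noteq> None \<longrightarrow> (\<forall>a. dpda_trans M q (Some a) X = None))"

inductive dpda_step ::
    "'a dpda \<Rightarrow> nat \<times> 'a list \<times> nat list \<Rightarrow> nat \<times> 'a list \<times> nat list \<Rightarrow> bool"
  for M :: "'a dpda" where
  read: "dpda_trans M q (Some a) X = Some (q', g)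
    \<Longrightarrow> dpda_step M (q, a # w, X # st) (q', w, g @ st)"
| silent: "dpda_trans M q None X = Some (q', g)
    \<Longrightarrow> dpda_step M (q, w, X # st) (q', w, g @ st)"

definition dpda_language :: "'a dpda \<Rightarrow> 'a list set" where
  "dpda_language M =
     {w. \<exists>f\<in>dpda_final M. \<exists>st.
       (dpda_step M)\<^sup>*\<^sup>* (dpda_start M, w, [dpda_bottom M]) (f, [], st)}"

definition deterministic_context_free_language :: "'a set \<Rightarrow> 'a list set \<Rightarrow> bool" where
  "deterministic_context_free_language A L \<longleftrightarrow>
     finite A \<and> (\<exists>M. wf_dpda A M \<and> L = dpda_language M)"

text \<open>
  The whole content of the working memory between two input symbols is a bit string, and its
  length is the number of bits in use. Processing a symbol or the end of the input (which rewinds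
  the input for the next pass) is an arbitrary randomized update of the memory; no bound is put
  on the time or the scratch space of a single update. Updates may depend on the index of the
  current pass (counted from 0), which is not charged as memory.

  Randomness is provided in both usual forms: fresh coins in every update, and a random string
  \<open>r\<close> drawn before the run, which can be inspected at any time and is not charged as memory.
  An algorithm without the latter has a constant \<open>random_string\<close>.
\<close>

type_synonym memory = "bool list"

record 'a streaming_algorithm =
  random_string :: "bool list pmf"
  init_memory :: "bool list \<Rightarrow> memory pmf"
  read_symbol :: "bool list \<Rightarrow> nat \<Rightarrow> memory \<Rightarrow> 'a \<Rightarrow> memory pmf"
  end_of_pass :: "bool list \<Rightarrow> nat \<Rightarrow> memory \<Rightarrow> memory pmf"
  verdict :: "bool list \<Rightarrow> memory \<Rightarrow> bool"

primrec read_word ::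
    "'a streaming_algorithm \<Rightarrow> bool list \<Rightarrow> nat \<Rightarrow> 'a list \<Rightarrow> memory \<Rightarrow> memory pmf" where
  "read_word A r k [] m = return_pmf m"
| "read_word A r k (a # w) m = bind_pmf (read_symbol A r k m a) (read_word A r k w)"

primrec after_passes ::
    "'a streaming_algorithm \<Rightarrow> bool list \<Rightarrow> 'a list \<Rightarrow> nat \<Rightarrow> memory pmf" where
  "after_passes A r w 0 = init_memory A r"
| "after_passes A r w (Suc k) =
     bind_pmf (after_passes A r w k)
       (\<lambda>m. bind_pmf (read_word A r k w m) (end_of_pass A r k))"

definition output_pmf :: "'a streaming_algorithm \<Rightarrow> nat \<Rightarrow> 'a list \<Rightarrow> bool pmf" where
  "output_pmf A p w =
     bind_pmf (random_string A) (\<lambda>r. map_pmf (verdict A r) (after_passes A r w p))"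

definition tests_membership ::
    "'a streaming_algorithm \<Rightarrow> nat \<Rightarrow> 'a list set \<Rightarrow> 'a list set \<Rightarrow> real \<Rightarrow> bool" where
  "tests_membership A p W L \<epsilon> \<longleftrightarrow>
     (\<forall>w\<in>W. measure_pmf.prob (output_pmf A p w) {b. b \<noteq> (w \<in> L)} \<le> \<epsilon>)"

text \<open>
  All memory contents that occur with positive probability in the course of the \<open>p\<close> passes over
  \<open>w\<close>: during pass \<open>k\<close> after having read \<open>i\<close> symbols, and at the very end.
\<close>

definition occurring_memories :: "'a streaming_algorithm \<Rightarrow> nat \<Rightarrow> 'a list \<Rightarrow> memory set" where
  "occurring_memories A p w =
     (\<Union>r\<in>set_pmf (random_string A).
        (\<Union>k<p. \<Union>i\<le>length w.
           set_pmf (bind_pmf (after_passes A r w k) (read_word A r k (take i w)))) \<union>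
        set_pmf (after_passes A r w p))"

definition uses_space :: "'a streaming_algorithm \<Rightarrow> nat \<Rightarrow> 'a list set \<Rightarrow> nat \<Rightarrow> bool" where
  "uses_space A p W s \<longleftrightarrow> (\<forall>w\<in>W. \<forall>m\<in>occurring_memories A p w. length m \<le> s)"

definition words_of_length :: "'a set \<Rightarrow> nat \<Rightarrow> 'a list set" where
  "words_of_length A n = {w \<in> lists A. length w = n}"

end

theory Submission
  imports Defs
begin

text \<open>
  The language computes the inner product modulo 2: the automaton pushes the bits of \<open>x\<close>, then
  pops them against the bits of \<open>y\<close> and keeps the parity of the matches in its state. Cutting the
  input between \<open>x\<close> and \<open>y\<close>, the acceptance probability of a \<open>p\<close>-pass algorithm with \<open>N\<close> memory
  contents is a sum of \<open>N\<^sup>2\<^sup>p\<^sup>+\<^sup>1\<close> products \<open>a x * b y\<close>, one for each sequence of memory contents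
  at the cut and at the ends of the passes. By Lindsey's lemma each product has correlation at most
  \<open>8 powr (m / 2)\<close> with the sign of the inner product of vectors of length \<open>m\<close>, while an
  algorithm with error \<open>\<epsilon>\<close> has correlation at least \<open>(1 - 2 * \<epsilon>) * 4 ^ m\<close>.
\<close>

section \<open>Lindsey's lemma\<close>

fun ip_sign :: "bool list \<Rightarrow> bool list \<Rightarrow> real" where
  "ip_sign (a # x) (b # y) = (if a \<and> b then -1 else 1) * ip_sign x y"
| "ip_sign _ _ = 1"

lemma finite_bool_lists_length: "finite {xs :: bool list. length xs = n}"
  using finite_lists_length_eq[of "UNIV :: bool set" n] by simp

lemma card_bool_lists_length: "card {xs :: bool list. length xs = n} = 2 ^ n"
  using card_lists_length_eq[of "UNIV :: bool set" n] by (simp add: card_UNIV_bool)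

lemma sum_bool_lists_Suc:
  fixes f :: "bool list \<Rightarrow> 'b::comm_monoid_add"
  shows "(\<Sum>x | length x = Suc n. f x) =
    (\<Sum>x | length x = n. f (True # x)) + (\<Sum>x | length x = n. f (False # x))"
proof -
  let ?S = "{x :: bool list. length x = n}"
  have "{x :: bool list. length x = Suc n} = (#) True ` ?S \<union> (#) False ` ?S"
    by (auto simp: length_Suc_conv image_iff)
  then have "(\<Sum>x | length x = Suc n. f x) = sum f ((#) True ` ?S) + sum f ((#) False ` ?S)"
    using finite_bool_lists_length[of n] by (simp only:) (rule sum.union_disjoint, auto)
  then show ?thesis
    by (simp add: sum.reindex)
qed

text \<open>The sign matrix is a Sylvester-Hadamard matrix, so its rows are orthogonal and it
  multiplies squared norms by \<open>2 ^ n\<close>. The vector \<open>b\<close> is arbitrary because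
  the induction splits it into two halves by the first bit.\<close>

lemma sum_ip_sign_squares:
  "(\<Sum>x | length x = n. (\<Sum>y | length y = n. ip_sign x y * b y)\<^sup>2) =
    2 ^ n * (\<Sum>y | length y = n. (b y)\<^sup>2)"
proof (induction n arbitrary: b)
  case 0
  then show ?case by simp
next
  case (Suc n)
  let ?u = "\<lambda>c x. \<Sum>y | length y = n. ip_sign x y * b (c # y)"
  have "(\<Sum>x | length x = Suc n. (\<Sum>y | length y = Suc n. ip_sign x y * b y)\<^sup>2) =
    (\<Sum>x | length x = n. (- ?u True x + ?u False x)\<^sup>2 + (?u True x + ?u False x)\<^sup>2)"
    by (simp add: sum_bool_lists_Suc sum.distrib sum_negf)
  \<comment> \<open>Parallelogram law: the first bit of \<open>x\<close> decides whether the two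
    half sums are subtracted or added.\<close>
  also have "\<dots> = (\<Sum>x | length x = n. 2 * (?u True x)\<^sup>2 + 2 * (?u False x)\<^sup>2)"
    by (intro sum.cong refl) (simp add: power2_eq_square algebra_simps)
  also have "\<dots> = 2 * (\<Sum>x | length x = n. (?u True x)\<^sup>2) + 2 * (\<Sum>x | length x = n. (?u False x)\<^sup>2)"
    by (simp add: sum.distrib sum_distrib_left)
  also have "\<dots> = 2 ^ Suc n * (\<Sum>y | length y = Suc n. (b y)\<^sup>2)"
    unfolding Suc.IH by (simp add: sum_bool_lists_Suc algebra_simps)
  finally show ?case .
qed

text \<open>Weights in \<open>{0..1}\<close> replace the usual indicator functions of rectangles,
  because the factors to be bounded are probabilities.\<close>

definition discrepancy_le ::
    "('x \<Rightarrow> 'y \<Rightarrow> real) \<Rightarrow> 'x set \<Rightarrow> 'y set \<Rightarrow> real \<Rightarrow> bool" where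
  "discrepancy_le \<sigma> X Y D \<longleftrightarrow>
     (\<forall>a b. a \<in> X \<rightarrow> {0..1} \<longrightarrow> b \<in> Y \<rightarrow> {0..1} \<longrightarrow> \<bar>\<Sum>x\<in>X. \<Sum>y\<in>Y. \<sigma> x y * a x * b y\<bar> \<le> D)"

lemma discrepancy_leD:
  assumes "discrepancy_le \<sigma> X Y D" "\<And>x. x \<in> X \<Longrightarrow> 0 \<le> a x \<and> a x \<le> 1"
    "\<And>y. y \<in> Y \<Longrightarrow> 0 \<le> b y \<and> b y \<le> 1"
  shows "\<bar>\<Sum>x\<in>X. \<Sum>y\<in>Y. \<sigma> x y * a x * b y\<bar> \<le> D"
  using assms by (simp add: discrepancy_le_def Pi_iff)

text \<open>Cauchy-Schwarz separates \<open>a\<close> from the image of \<open>b\<close> under the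
  sign matrix, whose norm is known from the Hadamard property.\<close>

lemma lindsey: "discrepancy_le ip_sign {x. length x = n} {y. length y = n} (sqrt (8 ^ n))"
  unfolding discrepancy_le_def
proof (intro allI impI)
  let ?S = "{x :: bool list. length x = n}"
  fix a b :: "bool list \<Rightarrow> real"
  assume a: "a \<in> ?S \<rightarrow> {0..1}" and b: "b \<in> ?S \<rightarrow> {0..1}"
  have squares: "(\<Sum>x\<in>?S. (f x)\<^sup>2) \<le> 2 ^ n" if "f \<in> ?S \<rightarrow> {0..1}" for f :: "bool list \<Rightarrow> real"
    using sum_bounded_above[of ?S "\<lambda>x. (f x)\<^sup>2" 1] that
    by (auto simp: card_bool_lists_length Pi_iff power_le_one)
  have "(\<Sum>x\<in>?S. \<Sum>y\<in>?S. ip_sign x y * a x * b y)\<^sup>2 =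
      (\<Sum>x\<in>?S. a x * (\<Sum>y\<in>?S. ip_sign x y * b y))\<^sup>2"
    by (simp add: sum_distrib_left mult_ac)
  also have "\<dots> \<le> (\<Sum>x\<in>?S. (a x)\<^sup>2) * (\<Sum>x\<in>?S. (\<Sum>y\<in>?S. ip_sign x y * b y)\<^sup>2)"
    by (rule Cauchy_Schwarz_ineq_sum)
  \<comment> \<open>One factor \<open>2 ^ n\<close> bounds the squared norm of \<open>a\<close>, one
    that of \<open>b\<close>, and one is the scaling of the sign matrix.\<close>
  also have "\<dots> \<le> 2 ^ n * (2 ^ n * 2 ^ n)"
    unfolding sum_ip_sign_squares
    by (intro mult_mono squares a b order_refl) (auto intro!: sum_nonneg mult_nonneg_nonneg)
  also have "\<dots> = 8 ^ n"
    by (simp flip: power_mult_distrib)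
  finally show "\<bar>\<Sum>x\<in>?S. \<Sum>y\<in>?S. ip_sign x y * a x * b y\<bar> \<le> sqrt (8 ^ n)"
    using real_sqrt_le_mono by fastforce
qed

section \<open>Streaming algorithms and discrepancy\<close>

lemma abs_sum_le:
  fixes f :: "'i \<Rightarrow> real" and C :: real
  assumes "\<And>i. i \<in> A \<Longrightarrow> \<bar>f i\<bar> \<le> C"
  shows "\<bar>sum f A\<bar> \<le> card A * C"
  by (rule order_trans[OF sum_abs sum_bounded_above]) (rule assms)

lemma pmf_bind_finite:
  assumes "finite M" "set_pmf P \<subseteq> M"
  shows "pmf (bind_pmf P f) z = (\<Sum>m\<in>M. pmf P m * pmf (f m) z)"
  unfolding pmf_bind using assms by (subst integral_measure_pmf[of M]) auto

lemma read_word_append: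
  "read_word A r k (u @ v) m = bind_pmf (read_word A r k u m) (read_word A r k v)"
  by (induction u arbitrary: m) (simp_all add: bind_return_pmf bind_assoc_pmf cong: bind_pmf_cong)

text \<open>A pass is split at the cut: \<open>m\<close> is the memory at its start,
  \<open>m'\<close> the memory at the cut. Given both, the first half depends on \<open>u\<close>
  only and the second on \<open>v\<close> only.\<close>

lemma pmf_after_passes_Suc:
  assumes "finite M" "set_pmf (after_passes A r (u @ v) k) \<subseteq> M"
    and "set_pmf (bind_pmf (after_passes A r (u @ v) k) (read_word A r k u)) \<subseteq> M"
  shows "pmf (after_passes A r (u @ v) (Suc k)) z =
    (\<Sum>m'\<in>M. \<Sum>m\<in>M. pmf (after_passes A r (u @ v) k) m * pmf (read_word A r k u m) m' *
       pmf (bind_pmf (read_word A r k v m') (end_of_pass A r k)) z)"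
proof -
  let ?P = "after_passes A r (u @ v) k"
  have "after_passes A r (u @ v) (Suc k) =
    bind_pmf (bind_pmf ?P (read_word A r k u))
      (\<lambda>m'. bind_pmf (read_word A r k v m') (end_of_pass A r k))"
    by (simp add: read_word_append bind_assoc_pmf)
  then show ?thesis
    by (simp only: pmf_bind_finite[OF assms(1,3)] pmf_bind_finite[OF assms(1,2), of "read_word A r k u"]
        sum_distrib_right)
qed

text \<open>The factors \<open>a\<close> and \<open>b\<close> are arbitrary so that the induction can absorb into them the
  transition probabilities of the two halves of a pass.\<close>

lemma after_passes_discrepancy:
  assumes "finite X" "finite Y" "finite M" and disc: "discrepancy_le \<sigma> X Y D"
    and ends: "\<And>x y k. x \<in> X \<Longrightarrow> y \<in> Y \<Longrightarrow> k < p \<Longrightarrow> set_pmf (after_passes A r (u x @ v y) k) \<subseteq> M"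
    and cuts: "\<And>x y k. x \<in> X \<Longrightarrow> y \<in> Y \<Longrightarrow> k < p \<Longrightarrow>
      set_pmf (bind_pmf (after_passes A r (u x @ v y) k) (read_word A r k (u x))) \<subseteq> M"
    and "k \<le> p"
    and "\<And>x. x \<in> X \<Longrightarrow> 0 \<le> a x \<and> a x \<le> 1" and "\<And>y. y \<in> Y \<Longrightarrow> 0 \<le> b y \<and> b y \<le> 1"
  shows "\<bar>\<Sum>x\<in>X. \<Sum>y\<in>Y. \<sigma> x y * a x * b y * pmf (after_passes A r (u x @ v y) k) z\<bar>
    \<le> real (card M) ^ (2 * k) * D"
  using assms(7-)
proof (induction k arbitrary: a b z)
  case 0
  \<comment> \<open>The initial memory does not depend on the input, so its probability is a
    constant that \<open>b\<close> can absorb.\<close>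
  have "\<bar>\<Sum>x\<in>X. \<Sum>y\<in>Y. \<sigma> x y * a x * (b y * pmf (init_memory A r) z)\<bar> \<le> D"
    using "0.prems" by (intro discrepancy_leD[OF disc]) (auto simp: mult_le_one pmf_le_1)
  then show ?case
    by (simp add: mult_ac)
next
  case (Suc k)
  let ?F = "\<lambda>x y m. pmf (after_passes A r (u x @ v y) k) m"
  \<comment> \<open>Multiplication by a probability keeps the weights between 0 and 1, as the
    induction hypothesis demands.\<close>
  define a' where "a' m m' x = a x * pmf (read_word A r k (u x) m) m'" for m m' x
  define b' where
    "b' m' y = b y * pmf (bind_pmf (read_word A r k (v y) m') (end_of_pass A r k)) z" for m' y
  have bound: "\<bar>\<Sum>x\<in>X. \<Sum>y\<in>Y. \<sigma> x y * a' m m' x * b' m' y * ?F x y m\<bar>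
      \<le> real (card M) ^ (2 * k) * D" for m m'
    using Suc.prems by (intro Suc.IH) (auto simp: a'_def b'_def mult_le_one pmf_le_1)
  have "(\<Sum>x\<in>X. \<Sum>y\<in>Y. \<sigma> x y * a x * b y * pmf (after_passes A r (u x @ v y) (Suc k)) z)
    = (\<Sum>x\<in>X. \<Sum>y\<in>Y. \<Sum>m'\<in>M. \<Sum>m\<in>M. \<sigma> x y * a' m m' x * b' m' y * ?F x y m)"
    using Suc.prems(1)
    by (intro sum.cong refl, subst pmf_after_passes_Suc[OF \<open>finite M\<close> ends cuts])
      (auto simp: a'_def b'_def sum_distrib_left mult_ac)
  also have "\<dots> = (\<Sum>m'\<in>M. \<Sum>m\<in>M. \<Sum>x\<in>X. \<Sum>y\<in>Y. \<sigma> x y * a' m m' x * b' m' y * ?F x y m)"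
    by (simp only: sum.swap[of _ M Y] sum.swap[of _ M X])
  \<comment> \<open>Summing over the memory at the start of the pass and at its cut costs one factor
    \<open>card M\<close> each, hence two per pass.\<close>
  also have "\<bar>\<dots>\<bar> \<le> card M * (card M * (real (card M) ^ (2 * k) * D))"
    by (intro abs_sum_le bound)
  also have "\<dots> = real (card M) ^ (2 * Suc k) * D"
    by (simp add: mult_ac)
  finally show ?case .
qed

section \<open>Bias of the output and averaging over the random string\<close>

text \<open>This is the expectation of the output read as a sign. \<open>True\<close> counts as
  \<open>-1\<close> to agree with \<open>ip_sign\<close>, which is \<open>-1\<close> on the pairs
  whose words belong to the language.\<close>

definition bias :: "bool pmf \<Rightarrow> real" where
  "bias P = pmf P False - pmf P True"

lemma abs_bias_le_1: "\<bar>bias P\<bar> \<le> 1"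
  unfolding bias_def using pmf_le_1[of P True] pmf_le_1[of P False] pmf_nonneg[of P True]
    pmf_nonneg[of P False] by linarith

lemma pmf_True_add_False: "pmf P True + pmf P False = 1"
proof -
  have "sum (pmf P) UNIV = 1"
    by (rule sum_pmf_eq_1) auto
  then show ?thesis
    by (simp add: UNIV_bool)
qed

lemma bias_map_finite:
  assumes "finite M" "set_pmf P \<subseteq> M"
  shows "bias (map_pmf f P) = (\<Sum>m\<in>M. (if f m then -1 else 1) * pmf P m)"
  unfolding bias_def map_pmf_def pmf_bind_finite[OF assms] sum_subtractf[symmetric]
  by (intro sum.cong) auto

lemma bias_bind: "bias (bind_pmf P f) = measure_pmf.expectation P (\<lambda>r. bias (f r))"
  unfolding bias_def pmf_bind
  by (subst Bochner_Integration.integral_diff)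
    (auto intro!: measure_pmf.integrable_const_bound[where B = 1] simp: pmf_le_1)

text \<open>For a fixed random string, summing over the final memory that determines the verdict
  adds one factor \<open>card M\<close> to the \<open>2 * p\<close> factors from the passes. The
  bound is uniform in the random string and therefore survives averaging.\<close>

lemma output_discrepancy:
  assumes "finite X" "finite Y" "finite M" and disc: "discrepancy_le \<sigma> X Y D"
    and mem: "\<And>x y. x \<in> X \<Longrightarrow> y \<in> Y \<Longrightarrow> occurring_memories A p (u x @ v y) \<subseteq> M"
  shows "\<bar>\<Sum>x\<in>X. \<Sum>y\<in>Y. \<sigma> x y * bias (output_pmf A p (u x @ v y))\<bar>
    \<le> real (card M) ^ (2 * p + 1) * D"
proof -
  let ?B = "\<lambda>r x y. bias (map_pmf (verdict A r) (after_passes A r (u x @ v y) p))"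
  have fixed: "\<bar>\<Sum>x\<in>X. \<Sum>y\<in>Y. \<sigma> x y * ?B r x y\<bar> \<le> real (card M) ^ (2 * p + 1) * D"
    if r: "r \<in> set_pmf (random_string A)" for r
  proof -
    let ?F = "\<lambda>x y. pmf (after_passes A r (u x @ v y) p)"
    let ?e = "\<lambda>m. if verdict A r m then -1 else 1 :: real"
    have cuts: "set_pmf (bind_pmf (after_passes A r (u x @ v y) k) (read_word A r k (take i (u x @ v y)))) \<subseteq> M"
      if "x \<in> X" "y \<in> Y" "k < p" "i \<le> length (u x @ v y)" for x y k i
      using mem[OF that(1,2)] that(3,4) r unfolding occurring_memories_def by blast
    have final: "set_pmf (after_passes A r (u x @ v y) p) \<subseteq> M" if "x \<in> X" "y \<in> Y" for x y
      using mem[OF that] r unfolding occurring_memories_def by blast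
    have bound: "\<bar>\<Sum>x\<in>X. \<Sum>y\<in>Y. \<sigma> x y * ?F x y m\<bar> \<le> real (card M) ^ (2 * p) * D" for m
    proof -
      have "\<bar>\<Sum>x\<in>X. \<Sum>y\<in>Y. \<sigma> x y * 1 * 1 * ?F x y m\<bar> \<le> real (card M) ^ (2 * p) * D"
      proof (rule after_passes_discrepancy[OF assms(1-4)])
        show "set_pmf (after_passes A r (u x @ v y) k) \<subseteq> M"
          if "x \<in> X" "y \<in> Y" "k < p" for x y k
          \<comment> \<open>A cut at position 0 gives the memory at the start of the pass.\<close>
          using cuts[OF that, of 0] by (simp add: bind_return_pmf')
        show "set_pmf (bind_pmf (after_passes A r (u x @ v y) k) (read_word A r k (u x))) \<subseteq> M"
          if "x \<in> X" "y \<in> Y" "k < p" for x y k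
          using cuts[OF that, of "length (u x)"] by simp
      qed auto
      then show ?thesis by simp
    qed
    have "(\<Sum>x\<in>X. \<Sum>y\<in>Y. \<sigma> x y * ?B r x y) = (\<Sum>x\<in>X. \<Sum>y\<in>Y. \<Sum>m\<in>M. ?e m * (\<sigma> x y * ?F x y m))"
      by (intro sum.cong refl, subst bias_map_finite[OF \<open>finite M\<close> final])
        (simp_all add: sum_distrib_left mult_ac)
    also have "\<dots> = (\<Sum>m\<in>M. ?e m * (\<Sum>x\<in>X. \<Sum>y\<in>Y. \<sigma> x y * ?F x y m))"
      by (simp only: sum.swap[of _ M Y] sum.swap[of _ M X] sum_distrib_left)
    also have "\<bar>\<dots>\<bar> \<le> card M * (real (card M) ^ (2 * p) * D)"
      by (intro abs_sum_le) (use bound in \<open>simp add: abs_mult\<close>)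
    finally show ?thesis
      by (simp add: mult_ac)
  qed
  have int: "integrable (measure_pmf (random_string A)) (\<lambda>r. ?B r x y)" for x y
    by (rule measure_pmf.integrable_const_bound[where B = 1]) (auto simp: abs_bias_le_1)
  have "(\<Sum>x\<in>X. \<Sum>y\<in>Y. \<sigma> x y * bias (output_pmf A p (u x @ v y))) =
      measure_pmf.expectation (random_string A) (\<lambda>r. \<Sum>x\<in>X. \<Sum>y\<in>Y. \<sigma> x y * ?B r x y)"
    by (simp add: output_pmf_def bias_bind Bochner_Integration.integral_sum int)
  also have "\<bar>\<dots>\<bar> \<le> measure_pmf.expectation (random_string A)
      (\<lambda>r. \<bar>\<Sum>x\<in>X. \<Sum>y\<in>Y. \<sigma> x y * ?B r x y\<bar>)"
    by (rule integral_abs_bound)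
  also have "\<dots> \<le> real (card M) ^ (2 * p + 1) * D"
    by (intro measure_pmf.integral_le_const integrable_abs Bochner_Integration.integrable_sum
        integrable_mult_right int) (use fixed in \<open>auto simp: AE_measure_pmf_iff\<close>)
  finally show ?thesis .
qed

text \<open>The bound \<open>4 ^ s\<close> rather than \<open>2 ^ (s + 1)\<close> is what excludes \<open>s = 0\<close> for every
  number of passes.\<close>

lemma card_bool_lists_le: "card {m :: bool list. length m \<le> s} \<le> 4 ^ s"
proof -
  have "card {m :: bool list. length m \<le> s} = (\<Sum>i\<le>s. 2 ^ i)"
    using card_lists_length_le[of "UNIV :: bool set" s] by (simp add: card_UNIV_bool)
  also have "\<dots> \<le> 4 ^ s"
  proof (induction s)
    case (Suc s)
    then show ?case
      using power_mono[of 2 "4::nat" s] by simp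
  qed simp
  finally show ?thesis .
qed

section \<open>The inner product language\<close>

text \<open>The calls 0, 1 and the returns 2, 3 stand for the bits 0, 1 of the first and the second
  vector.\<close>

fun ip_step :: "nat \<times> nat list \<Rightarrow> nat \<Rightarrow> nat \<times> nat list" where
  "ip_step (q, st) a =
     (if a \<le> 1 then (q, a # st)
      else case st of [] \<Rightarrow> (q, []) | g # st' \<Rightarrow> (if g = 1 \<and> a = 3 then 1 - q else q, st'))"

text \<open>The restriction to \<open>lists {0, 1, 2, 3}\<close> matters: \<open>ip_step\<close>
  treats every letter above 1 as a return, including those outside the alphabet.\<close>

definition ip_language :: "nat list set" where
  "ip_language = {w \<in> lists {0, 1, 2, 3}. fst (foldl ip_step (0, []) w) = 1}"

section \<open>A visibly pushdown automaton for the inner product\<close>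

definition ip_vpa :: "nat vpa" where
  "ip_vpa =
     \<lparr>vpa_states = {0, 1}, vpa_initial = {0}, vpa_final = {1}, vpa_stack = {0, 1},
      vpa_call = {(q, a, q', g). q \<in> {0, 1} \<and> a \<in> {0, 1} \<and> q' = q \<and> g = a},
      vpa_return = {(q, a, z, q'). q \<in> {0, 1} \<and> a \<in> {2, 3} \<and> z \<in> {None, Some 0, Some 1} \<and>
        q' = (if z = Some 1 \<and> a = 3 then 1 - q else q)},
      vpa_internal = {}\<rparr>"

lemma wf_ip_vpa: "wf_vpa {0, 1} {2, 3} {} ip_vpa"
  unfolding wf_vpa_def
proof (intro conjI)
  show "vpa_call ip_vpa \<subseteq> vpa_states ip_vpa \<times> {0, 1} \<times> vpa_states ip_vpa \<times> vpa_stack ip_vpa"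
    by (auto simp: ip_vpa_def)
  show "vpa_return ip_vpa \<subseteq> vpa_states ip_vpa \<times> {2, 3} \<times>
      insert None (Some ` vpa_stack ip_vpa) \<times> vpa_states ip_vpa"
    by (clarify, simp add: ip_vpa_def, elim conjE disjE) simp_all
qed (simp_all add: ip_vpa_def)

lemma ip_vpa_transitions:
  "(q, a, q', g) \<in> vpa_call ip_vpa \<longleftrightarrow> q \<in> {0, 1} \<and> a \<in> {0, 1} \<and> q' = q \<and> g = a"
  "(q, a, Some g, q') \<in> vpa_return ip_vpa \<longleftrightarrow> q \<in> {0, 1} \<and> a \<in> {2, 3} \<and> g \<in> {0, 1} \<and>
     q' = (if g = 1 \<and> a = 3 then 1 - q else q)"
  "(q, a, None, q') \<in> vpa_return ip_vpa \<longleftrightarrow> q \<in> {0, 1} \<and> a \<in> {2, 3} \<and> q' = q"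
  "(q, a, q') \<notin> vpa_internal ip_vpa"
  by (simp_all add: ip_vpa_def)

lemma ip_vpa_run_sound:
  "vpa_run ip_vpa c w d \<Longrightarrow> w \<in> lists {0, 1, 2, 3} \<and> d = foldl ip_step c w"
  by (induction rule: vpa_run.induct) (auto simp: ip_vpa_transitions)

text \<open>State and stack must consist of 0 and 1 for a transition to exist. The converse needs no
  such assumption, since every transition used in a run carries this information.\<close>

lemma ip_vpa_run_complete:
  assumes "w \<in> lists {0, 1, 2, 3}" "q \<in> {0, 1}" "st \<in> lists {0, 1}"
  shows "vpa_run ip_vpa (q, st) w (foldl ip_step (q, st) w)"
  using assms
proof (induction w arbitrary: q st rule: list.induct)
  case Nil
  then show ?case by (simp add: vpa_run.empty)
next
  case (Cons a w)
  have IH: "vpa_run ip_vpa (q', st') w (foldl ip_step (q', st') w)"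
    if "q' \<in> {0, 1}" "st' \<in> lists {0, 1}" for q' st'
    using Cons.IH Cons.prems(1) that by simp
  show ?case
  proof (cases "a \<in> {0, 1}")
    case True
    then have "(q, a, q, a) \<in> vpa_call ip_vpa"
      using Cons.prems by (simp add: ip_vpa_transitions)
    moreover have "vpa_run ip_vpa (q, a # st) w (foldl ip_step (q, a # st) w)"
      using True Cons.prems by (intro IH) auto
    ultimately show ?thesis
      using True by (auto intro: vpa_run.call)
  next
    case False
    then have a: "a \<in> {2, 3}"
      using Cons.prems(1) by auto
    then have "\<not> a \<le> 1"
      by auto
    show ?thesis
    proof (cases st)
      case Nil
      have "(q, a, None, q) \<in> vpa_return ip_vpa"
        using a Cons.prems by (simp add: ip_vpa_transitions)
      moreover have "vpa_run ip_vpa (q, []) w (foldl ip_step (q, []) w)"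
        using Cons.prems by (intro IH) auto
      ultimately show ?thesis
        using \<open>\<not> a \<le> 1\<close> Nil by (simp add: vpa_run.return_bottom)
    next
      case (Cons g st')
      let ?q = "if g = 1 \<and> a = 3 then 1 - q else q"
      have "(q, a, Some g, ?q) \<in> vpa_return ip_vpa"
        using a Cons.prems Cons by (simp add: ip_vpa_transitions)
      moreover have "vpa_run ip_vpa (?q, st') w (foldl ip_step (?q, st') w)"
        using Cons.prems Cons by (intro IH) auto
      ultimately have "vpa_run ip_vpa (q, g # st') (a # w) (foldl ip_step (?q, st') w)"
        by (rule vpa_run.return_pop)
      then show ?thesis
        using \<open>\<not> a \<le> 1\<close> Cons by simp
    qed
  qed
qed

lemma ip_language_vpa: "ip_language = vpa_language ip_vpa"
proof -
  have "w \<in> vpa_language ip_vpa \<longleftrightarrow> (\<exists>st. vpa_run ip_vpa (0, []) w (1, st))" for w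
    by (simp add: vpa_language_def ip_vpa_def)
  moreover have "vpa_run ip_vpa (0, []) w d \<longleftrightarrow>
      w \<in> lists {0, 1, 2, 3} \<and> foldl ip_step (0, []) w = d" for w d
    using ip_vpa_run_sound[of "(0, [])" w d] ip_vpa_run_complete[of w 0 "[]"] by auto
  ultimately show ?thesis
    by (auto simp: ip_language_def prod_eq_iff)
qed

section \<open>A deterministic pushdown automaton for the same language\<close>

text \<open>Stack symbol \<open>2\<close> is the bottom marker. A return that finds it on top puts
  it back, which mirrors a return on the implicit marker of \<open>ip_vpa\<close> and keeps the
  stack nonempty.\<close>

definition ip_dpda :: "nat dpda" where
  "ip_dpda =
     \<lparr>dpda_states = {0, 1}, dpda_stack = {0, 1, 2}, dpda_start = 0, dpda_bottom = 2,
      dpda_final = {1},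
      dpda_trans = (\<lambda>q x X. case x of None \<Rightarrow> None | Some a \<Rightarrow>
        if q \<in> {0, 1} \<and> X \<in> {0, 1, 2} \<and> a \<in> {0, 1, 2, 3}
        then Some (if a \<le> 1 then (q, [a, X]) else if X = 2 then (q, [2])
          else (if X = 1 \<and> a = 3 then 1 - q else q, []))
        else None)\<rparr>"

lemma wf_ip_dpda: "wf_dpda {0, 1, 2, 3} ip_dpda"
  unfolding wf_dpda_def ip_dpda_def by (auto split: option.splits if_splits)

lemma ip_step_closed:
  assumes "q \<in> {0, 1}" "st \<in> lists {0, 1}" "ip_step (q, st) a = (q', st')"
  shows "q' \<in> {0, 1}" "st' \<in> lists {0, 1}"
  using assms by (auto split: if_splits list.splits)

lemma ip_dpda_step_iff:
  assumes "q \<in> {0, 1}" "st \<in> lists {0, 1}" "ip_step (q, st) a = (q', st')"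
  shows "dpda_step ip_dpda (q, a # w, st @ [2]) c \<longleftrightarrow>
    a \<in> {0, 1, 2, 3} \<and> c = (q', w, st' @ [2])"
  using assms
  by (cases st) (auto simp: dpda_step.simps ip_dpda_def split: if_splits)

lemma ip_dpda_no_step_Nil: "\<not> dpda_step ip_dpda (q, [], st) c"
  by (auto simp: dpda_step.simps ip_dpda_def)

text \<open>Without silent moves, each step reads one letter and its successor is unique, so both
  inclusions follow from a single induction on the input.\<close>

lemma ip_dpda_steps_iff:
  assumes "q \<in> {0, 1}" "st \<in> lists {0, 1}"
  shows "(dpda_step ip_dpda)\<^sup>*\<^sup>* (q, w, st @ [2]) (f, [], st') \<longleftrightarrow>
    w \<in> lists {0, 1, 2, 3} \<and> f = fst (foldl ip_step (q, st) w) \<and> st' = snd (foldl ip_step (q, st) w) @ [2]"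
  using assms
proof (induction w arbitrary: q st)
  case Nil
  have "(dpda_step ip_dpda)\<^sup>*\<^sup>* (q, [], st @ [2]) c \<longleftrightarrow> c = (q, [], st @ [2])" for c
    by (metis converse_rtranclpE ip_dpda_no_step_Nil rtranclp.rtrancl_refl)
  then show ?case
    by auto
next
  case (Cons a w)
  obtain q' t where step: "ip_step (q, st) a = (q', t)"
    by fastforce
  \<comment> \<open>The target has no input left, so the run is not empty and its first step can be
    split off.\<close>
  have "(dpda_step ip_dpda)\<^sup>*\<^sup>* (q, a # w, st @ [2]) (f, [], st') \<longleftrightarrow>
      (\<exists>c. dpda_step ip_dpda (q, a # w, st @ [2]) c \<and> (dpda_step ip_dpda)\<^sup>*\<^sup>* c (f, [], st'))"
  proof
    assume "(dpda_step ip_dpda)\<^sup>*\<^sup>* (q, a # w, st @ [2]) (f, [], st')"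
    then show "\<exists>c. dpda_step ip_dpda (q, a # w, st @ [2]) c \<and> (dpda_step ip_dpda)\<^sup>*\<^sup>* c (f, [], st')"
      by (cases rule: converse_rtranclpE) blast+
  qed (blast intro: converse_rtranclp_into_rtranclp)
  also have "\<dots> \<longleftrightarrow>
      a \<in> {0, 1, 2, 3} \<and> (dpda_step ip_dpda)\<^sup>*\<^sup>* (q', w, t @ [2]) (f, [], st')"
    unfolding ip_dpda_step_iff[OF Cons.prems step] by blast
  also have "\<dots> \<longleftrightarrow> a # w \<in> lists {0, 1, 2, 3} \<and> f = fst (foldl ip_step (q, st) (a # w)) \<and>
      st' = snd (foldl ip_step (q, st) (a # w)) @ [2]"
    unfolding Cons.IH[OF ip_step_closed[OF Cons.prems step]] foldl_Cons step Cons_in_lists_iff by blast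
  finally show ?case .
qed

lemma ip_language_dpda: "ip_language = dpda_language ip_dpda"
proof -
  have "w \<in> dpda_language ip_dpda \<longleftrightarrow> (\<exists>st. (dpda_step ip_dpda)\<^sup>*\<^sup>* (0, w, [] @ [2]) (1, [], st))" for w
    by (simp add: dpda_language_def ip_dpda_def)
  then have "w \<in> dpda_language ip_dpda \<longleftrightarrow> w \<in> ip_language" for w
    using ip_dpda_steps_iff[of 0 "[]" w 1] by (auto simp: ip_language_def simp del: in_lists_conv_set)
  then show ?thesis
    by blast
qed

section \<open>Pairs of vectors as words\<close>

text \<open>The reversal puts the first bit of \<open>x\<close> on top of the stack, where it meets
  the first bit of \<open>y\<close>.\<close>

definition call_bits :: "bool list \<Rightarrow> nat list" where
  "call_bits x = rev (map of_bool x)"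

definition return_bits :: "bool list \<Rightarrow> nat list" where
  "return_bits y = map (\<lambda>b. 2 + of_bool b) y"

lemma foldl_ip_step_calls: "set w \<subseteq> {0, 1} \<Longrightarrow> foldl ip_step (q, st) w = (q, rev w @ st)"
  by (induction w arbitrary: st) auto

lemma ip_sign_cases: "length x = length y \<Longrightarrow> ip_sign x y = 1 \<or> ip_sign x y = -1"
  by (induction x y rule: list_induct2) auto

lemma foldl_ip_step_returns:
  assumes "length x = length y" "q \<in> {0, 1}"
  shows "foldl ip_step (q, map of_bool x) (return_bits y) = (if ip_sign x y = 1 then q else 1 - q, [])"
  using assms
proof (induction x y arbitrary: q rule: list_induct2)
  case Nil
  then show ?case by (simp add: return_bits_def)
next
  case (Cons a x b y)
  let ?q = "if a \<and> b then 1 - q else q"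
  have "ip_step (q, of_bool a # map of_bool x) (2 + of_bool b) = (?q, map of_bool x)"
    by (cases a; cases b) simp_all
  then have "foldl ip_step (q, map of_bool (a # x)) (return_bits (b # y)) =
      foldl ip_step (?q, map of_bool x) (return_bits y)"
    by (simp add: return_bits_def del: ip_step.simps)
  also have "\<dots> = (if ip_sign x y = 1 then ?q else 1 - ?q, [])"
    by (rule Cons.IH) (use Cons.prems in \<open>cases "a \<and> b"; simp; linarith\<close>)
  \<comment> \<open>Truncated subtraction is harmless: \<open>1 - (1 - q) = q\<close> because
    \<open>q\<close> is 0 or 1.\<close>
  also have "\<dots> = (if ip_sign (a # x) (b # y) = 1 then q else 1 - q, [])"
    using Cons.prems ip_sign_cases[OF Cons.hyps] by (elim insertE disjE emptyE) simp_all
  finally show ?case .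
qed

text \<open>The trailing calls only push and leave the parity alone. They serve as padding to reach
  odd lengths.\<close>

lemma call_return_bits_in_ip_language:
  assumes "length x = length y"
  shows "call_bits x @ return_bits y @ replicate k 0 \<in> ip_language \<longleftrightarrow> ip_sign x y = -1"
proof -
  have calls: "set (call_bits x) \<subseteq> {0, 1}" "rev (call_bits x) = map of_bool x"
    by (auto simp: call_bits_def)
  have "foldl ip_step (0, []) (call_bits x) = (0, map of_bool x)"
    by (simp only: foldl_ip_step_calls[OF calls(1)] calls(2) append_Nil2)
  moreover have "foldl ip_step (0, map of_bool x) (return_bits y) = (if ip_sign x y = 1 then 0 else 1, [])"
    using foldl_ip_step_returns[OF assms, of 0] by simp
  moreover have "foldl ip_step (q, []) (replicate k 0) = (q, replicate k 0)" for q
    by (subst foldl_ip_step_calls) auto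
  ultimately have "fst (foldl ip_step (0, []) (call_bits x @ return_bits y @ replicate k 0)) =
      (if ip_sign x y = 1 then 0 else 1)"
    by (simp only: foldl_append fst_conv)
  moreover have "call_bits x @ return_bits y @ replicate k 0 \<in> lists {0, 1, 2, 3}"
    by (auto simp: call_bits_def return_bits_def)
  ultimately show ?thesis
    using ip_sign_cases[OF assms] by (auto simp: ip_language_def simp del: in_lists_conv_set)
qed

section \<open>The space lower bound\<close>

text \<open>The total correlation of bias and sign is bounded on both sides: from below by
  correctness on each of the \<open>4 ^ (n div 2)\<close> pairs, from above by
  \<open>output_discrepancy\<close> with at most \<open>4 ^ s\<close> memory contents.\<close>

lemma ip_language_communication_bound:
  assumes tests: "tests_membership A p (words_of_length {0, 1, 2, 3} n) ip_language \<epsilon>"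
    and space: "uses_space A p (words_of_length {0, 1, 2, 3} n) s"
  shows "(1 - 2 * \<epsilon>) * 4 ^ (n div 2) \<le> 4 ^ (s * (2 * p + 1)) * sqrt (8 ^ (n div 2))"
proof -
  define m where "m = n div 2"
  let ?S = "{x :: bool list. length x = m}" and ?M = "{m :: memory. length m \<le> s}"
  define v where "v y = return_bits y @ replicate (n mod 2) 0" for y
  have words: "call_bits x @ v y \<in> words_of_length {0, 1, 2, 3} n" if "x \<in> ?S" "y \<in> ?S" for x y
  proof -
    have "length (call_bits x @ v y) = m + (m + n mod 2)"
      using that by (simp add: call_bits_def v_def return_bits_def)
    also have "\<dots> = n"
      unfolding m_def by presburger
    finally have "length (call_bits x @ v y) = n" .
    moreover have "call_bits x @ v y \<in> lists {0, 1, 2, 3}"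
      by (auto simp: call_bits_def v_def return_bits_def)
    ultimately show ?thesis
      unfolding words_of_length_def by blast
  qed
  have "finite ?M"
    using finite_lists_length_le[of "UNIV :: bool set" s] by simp
  have correct: "1 - 2 * \<epsilon> \<le> ip_sign x y * bias (output_pmf A p (call_bits x @ v y))"
    if "x \<in> ?S" "y \<in> ?S" for x y
  proof -
    let ?P = "output_pmf A p (call_bits x @ v y)"
    have len: "length x = length y"
      using that by simp
    have "measure_pmf.prob ?P {b. b \<noteq> (call_bits x @ v y \<in> ip_language)} \<le> \<epsilon>"
      using tests words[OF that] unfolding tests_membership_def by blast
    \<comment> \<open>Exactly one verdict is wrong, so the error event is a singleton and its
      probability is a value of \<open>pmf\<close>.\<close>
    also have "{b. b \<noteq> (call_bits x @ v y \<in> ip_language)} = {ip_sign x y \<noteq> -1}"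
      unfolding v_def call_return_bits_in_ip_language[OF len] by blast
    finally have error: "pmf ?P (ip_sign x y \<noteq> -1) \<le> \<epsilon>"
      by (simp only: measure_pmf_single)
    show ?thesis
      using ip_sign_cases[OF len]
    proof
      assume sign: "ip_sign x y = 1"
      then have "pmf ?P True \<le> \<epsilon>"
        using error by simp
      then show ?thesis
        using pmf_True_add_False[of ?P] by (simp add: sign bias_def)
    next
      assume sign: "ip_sign x y = -1"
      then have "pmf ?P False \<le> \<epsilon>"
        using error by simp
      then show ?thesis
        using pmf_True_add_False[of ?P] by (simp add: sign bias_def)
    qed
  qed
  have "(4 :: real) ^ m = 2 ^ m * 2 ^ m"
    by (simp flip: power_mult_distrib)
  then have "(1 - 2 * \<epsilon>) * 4 ^ m = (\<Sum>x\<in>?S. \<Sum>y\<in>?S. 1 - 2 * \<epsilon>)"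
    by (simp add: card_bool_lists_length)
  also have "\<dots> \<le> (\<Sum>x\<in>?S. \<Sum>y\<in>?S. ip_sign x y * bias (output_pmf A p (call_bits x @ v y)))"
    by (intro sum_mono correct)
  also have "\<dots> \<le> real (card ?M) ^ (2 * p + 1) * sqrt (8 ^ m)"
  proof (rule order_trans[OF abs_ge_self output_discrepancy[OF finite_bool_lists_length
          finite_bool_lists_length \<open>finite ?M\<close> lindsey]])
    show "occurring_memories A p (call_bits x @ v y) \<subseteq> ?M" if "x \<in> ?S" "y \<in> ?S" for x y
      using space words[OF that] unfolding uses_space_def by blast
  qed
  also have "\<dots> \<le> (4 ^ s) ^ (2 * p + 1) * sqrt (8 ^ m)"
    using of_nat_mono[OF card_bool_lists_le[of s], where 'a = real]
    by (intro mult_right_mono power_mono) simp_all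
  finally show ?thesis
    by (simp only: m_def power_mult)
qed

text \<open>Taking logarithms to base 2 in the correlation bound makes it linear in \<open>n\<close>
  and \<open>s * p\<close>. The threshold on \<open>n\<close> keeps the loss from the error and from
  rounding \<open>n div 2\<close> within half of the main term.\<close>

lemma ip_language_space_bound:
  assumes "\<epsilon> < 1 / 2" "p \<ge> 1" and n: "real n \<ge> 2 + 8 * log 2 (1 / (1 - 2 * \<epsilon>))"
    and "tests_membership A p (words_of_length {0, 1, 2, 3} n) ip_language \<epsilon>"
    and "uses_space A p (words_of_length {0, 1, 2, 3} n) s"
  shows "real s \<ge> 1 / 48 * (real n / real p)"
proof -
  define \<delta> where "\<delta> = 1 - 2 * \<epsilon>"
  define m where "m = n div 2"
  define K where "K = s * (2 * p + 1)"
  define T where "T = s * p"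
  have "\<delta> > 0"
    using assms(1) by (simp add: \<delta>_def)
  have "n \<le> 2 * m + 1"
    unfolding m_def by presburger
  then have m: "real n \<le> real (2 * m + 1)"
    by (rule of_nat_mono)
  have two: "sqrt (8 ^ m) = 2 powr (3 * m / 2)" "4 ^ k = 2 powr (2 * k)" for k :: nat
  proof -
    have "(8::real) ^ m = 2 ^ (3 * m)" "(4::real) ^ k = 2 ^ (2 * k)"
      by (simp_all add: power_mult)
    then show "sqrt (8 ^ m) = 2 powr (3 * m / 2)" "4 ^ k = 2 powr (2 * k)"
      by (simp_all add: powr_half_sqrt[symmetric] powr_powr flip: powr_realpow)
  qed
  have "2 powr (log 2 \<delta> + 2 * m) = \<delta> * 4 ^ m"
    using \<open>\<delta> > 0\<close> by (simp add: powr_add two)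
  also have "\<dots> \<le> 4 ^ K * sqrt (8 ^ m)"
    unfolding \<delta>_def m_def K_def by (rule ip_language_communication_bound) fact+
  also have "\<dots> = 2 powr (2 * K + 3 * m / 2)"
    by (simp add: two powr_add)
  finally have "log 2 \<delta> + real m / 2 \<le> 2 * real K"
    by simp
  \<comment> \<open>Since \<open>p\<close> is at least 1, \<open>2 * p + 1\<close> is at most
    \<open>3 * p\<close>.\<close>
  moreover have "real K \<le> real (3 * T)"
    using \<open>p \<ge> 1\<close> by (intro of_nat_mono) (simp add: K_def T_def algebra_simps)
  moreover have "2 - 8 * log 2 \<delta> \<le> real n"
    using n \<open>\<delta> > 0\<close> by (simp add: \<delta>_def log_divide)
  ultimately have "real n \<le> 48 * real T"
    \<comment> \<open>Here \<open>m / 2 \<ge> (n - 1) / 4\<close> and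
      \<open>log 2 \<delta> \<ge> 1 / 4 - n / 8\<close>, so \<open>n / 8\<close> is at most
      \<open>2 * K\<close>, hence at most \<open>6 * T\<close>. This is where 48 comes from.\<close>
    using m by simp
  then show ?thesis
    using \<open>p \<ge> 1\<close> by (simp add: T_def field_simps)
qed

theorem theorem5:
  shows "\<exists>(calls :: nat set) returns internals L.
    visibly_pushdown_language calls returns internals L \<and>
    deterministic_context_free_language (calls \<union> returns \<union> internals) L \<and>
    (\<forall>\<epsilon><1/2. \<exists>c>0. \<exists>n0. \<forall>p\<ge>1. \<forall>n\<ge>n0. \<forall>A s.
       tests_membership A p (words_of_length (calls \<union> returns \<union> internals) n) L \<epsilon> \<longrightarrow>
       uses_space A p (words_of_length (calls \<union> returns \<union> internals) n) s \<longrightarrow>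
       real s \<ge> c * (real n / real p))"
proof (intro exI conjI)
  have alphabet: "{0, 1} \<union> {2, 3} \<union> {} = {0, 1, 2, 3 :: nat}"
    by auto
  show "visibly_pushdown_language {0, 1} {2, 3} {} ip_language"
    using wf_ip_vpa ip_language_vpa by (auto simp: visibly_pushdown_language_def)
  show "deterministic_context_free_language ({0, 1} \<union> {2, 3} \<union> {}) ip_language"
    unfolding alphabet using wf_ip_dpda ip_language_dpda
    by (auto simp: deterministic_context_free_language_def)
  show "\<forall>\<epsilon><1/2. \<exists>c>0. \<exists>n0. \<forall>p\<ge>1. \<forall>n\<ge>n0. \<forall>A s.
       tests_membership A p (words_of_length ({0, 1} \<union> {2, 3} \<union> {}) n) ip_language \<epsilon> \<longrightarrow>
       uses_space A p (words_of_length ({0, 1} \<union> {2, 3} \<union> {}) n) s \<longrightarrow>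
       real s \<ge> c * (real n / real p)"
    unfolding alphabet
  proof (intro allI impI)
    fix \<epsilon> :: real
    assume \<epsilon>: "\<epsilon> < 1 / 2"
    \<comment> \<open>Only the threshold depends on \<open>\<epsilon>\<close>; the constant
      \<open>1 / 48\<close> is absolute.\<close>
    define n0 where "n0 = nat \<lceil>2 + 8 * log 2 (1 / (1 - 2 * \<epsilon>))\<rceil>"
    have "real n \<ge> 2 + 8 * log 2 (1 / (1 - 2 * \<epsilon>))" if "n \<ge> n0" for n
      using that unfolding n0_def by linarith
    then have "\<forall>p\<ge>1. \<forall>n\<ge>n0. \<forall>A s.
       tests_membership A p (words_of_length {0, 1, 2, 3} n) ip_language \<epsilon> \<longrightarrow>
       uses_space A p (words_of_length {0, 1, 2, 3} n) s \<longrightarrow>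
       real s \<ge> 1 / 48 * (real n / real p)"
      using ip_language_space_bound[OF \<epsilon>] by blast
    then show "\<exists>c>0. \<exists>n0. \<forall>p\<ge>1. \<forall>n\<ge>n0. \<forall>A s.
       tests_membership A p (words_of_length {0, 1, 2, 3} n) ip_language \<epsilon> \<longrightarrow>
       uses_space A p (words_of_length {0, 1, 2, 3} n) s \<longrightarrow>
       real s \<ge> c * (real n / real p)"
      by (intro exI[of _ "1 / 48 :: real"] conjI exI[of _ n0]) simp_all
  qed
qed

end
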